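(* Let $N\ge 0$ be an integer. For generic complex parameters $a,b,c,d,q$ (i.e. on a nonempty Zariski-open set of parameters), there are unique coefficients $R_k^l=R_k^l(a,b,c,d;N;q)$, $0\le k,l\le N$, such that for each $k$ $$h_k(x;a)h_{N-k}(x;b)=\sum_{l=0}^N R_k^l(a,b,c,d;N;q)\,h_l(x;c)h_{N-l}(x;d)$$ as polynomials in $x$, and they are given by $$R_k^l=q^{l(l-N)}\binom{N}{l}_q\frac{(ac,a/c;q)_k\,(q^{N-l}bd,b/d;q)_l\,(b/c;q)_{N-k}\,(b/c;q)_{N-l}\,(bc;q)_{N-k}}{(q^{l-N}c/d;q)_l\,(q^{-l}d/c;q)_{N-l}\,(cd;q)_N\,(b/c;q)_N\,(bc;q)_l}$$ $$\times{}_{10}W_9\big(q^{-N}c/b;\,q^{-k},q^{-l},q^{k-N}a/b,q^{l-N}c/d,cd,q^{1-N}/(ab),qc/b;\,q,q\big).$$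
   Context: $(a;q)_k=\prod_{j=0}^{k-1}(1-aq^j)$, $(a_1,\dots,a_n;q)_k=\prod_i(a_i;q)_k$, $\binom{N}{l}_q=\frac{(q;q)_N}{(q;q)_l(q;q)_{N-l}}$. $h_k(x;a)=\prod_{j=0}^{k-1}(1-axq^j+a^2q^{2j})$. ${}_{r+1}W_r(a;b_1,\dots,b_{r-2};q,z)=\sum_{k\ge0}\frac{1-aq^{2k}}{1-a}\frac{(a,b_1,\dots,b_{r-2};q)_k}{(q,aq/b_1,\dots,aq/b_{r-2};q)_k}z^k$ (terminating here because of the parameter $q^{-k}$). *)

theory Defs
  imports Complex_Main "HOL-Computational_Algebra.Polynomial"
begin

definition qpoch :: "complex \<Rightarrow> complex \<Rightarrow> nat \<Rightarrow> complex" where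
  "qpoch a q k = (\<Prod>j<k. 1 - a * q ^ j)"

definition qbinom :: "nat \<Rightarrow> nat \<Rightarrow> complex \<Rightarrow> complex" where
  "qbinom N l q = qpoch q q N / (qpoch q q l * qpoch q q (N - l))"

definition h_poly :: "nat \<Rightarrow> complex \<Rightarrow> complex \<Rightarrow> complex poly" where
  "h_poly k a q = (\<Prod>j<k. [:1 + a^2 * q^(2*j), - a * q^j:])"

definition vwp_term :: "complex \<Rightarrow> complex list \<Rightarrow> complex \<Rightarrow> complex \<Rightarrow> nat \<Rightarrow> complex" where
  "vwp_term a bs q z n =
     (1 - a * q^(2*n)) / (1 - a) *
     (qpoch a q n * (\<Prod>b\<leftarrow>bs. qpoch b q n)) /
     (qpoch q q n * (\<Prod>b\<leftarrow>bs. qpoch (a * q / b) q n)) * z ^ n"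

definition vwpW :: "complex \<Rightarrow> complex list \<Rightarrow> complex \<Rightarrow> complex \<Rightarrow> complex" where
  "vwpW a bs q z = (\<Sum>n. vwp_term a bs q z n)"

text \<open>Evaluation of a polynomial in the five variables (a,b,c,d,q), given by a
  finitely supported coefficient function on exponent tuples.\<close>
definition mpoly5_eval ::
  "(nat \<times> nat \<times> nat \<times> nat \<times> nat \<Rightarrow> complex) \<Rightarrow> complex \<Rightarrow> complex \<Rightarrow> complex \<Rightarrow> complex \<Rightarrow> complex \<Rightarrow> complex" where
  "mpoly5_eval C a b c d q =
     (\<Sum>e\<in>{e. C e \<noteq> 0}. case e of (i, j, k, l, m) \<Rightarrow> C e * a^i * b^j * c^k * d^l * q^m)"

definition Rcoef :: "complex \<Rightarrow> complex \<Rightarrow> complex \<Rightarrow> complex \<Rightarrow> nat \<Rightarrow> complex \<Rightarrow> nat \<Rightarrow> nat \<Rightarrow> complex" where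
  "Rcoef a b c d N q k l =
     q powi (int l * (int l - int N)) * qbinom N l q *
     (qpoch (a*c) q k * qpoch (a/c) q k * qpoch (q^(N-l) * b * d) q l * qpoch (b/d) q l *
      qpoch (b/c) q (N-k) * qpoch (b/c) q (N-l) * qpoch (b*c) q (N-k)) /
     (qpoch (q powi (int l - int N) * c / d) q l * qpoch (q powi (- int l) * d / c) q (N-l) *
      qpoch (c*d) q N * qpoch (b/c) q N * qpoch (b*c) q l) *
     vwpW (q powi (- int N) * c / b)
       [q powi (- int k), q powi (- int l), q powi (int k - int N) * a / b,
        q powi (int l - int N) * c / d, c * d, q powi (1 - int N) / (a * b), q * c / b] q q"

end

theory Submission
  imports Defs
begin

text \<open>
  Extracting one factor at a time shows that \<open>h_n(x;a)\<close> expands in the products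
  \<open>h_l(x;b) h_m(x;c)\<close> with \<open>l + m = n\<close>, the coefficients being pure products of
  $q$-shifted factorials. Apply this twice: expanding \<open>h_k(x;a)\<close> in
  \<open>h_{k-j}(x;bq^{N-k}) h_j(x;c)\<close> turns \<open>h_k(x;a) h_{N-k}(x;b)\<close> into a combination of the
  \<open>h_{N-j}(x;b) h_j(x;c)\<close>, and expanding \<open>h_{N-j}(x;b)\<close> in \<open>h_{l-j}(x;cq^j) h_{N-l}(x;d)\<close>
  then yields \<open>h_l(x;c) h_{N-l}(x;d)\<close>. The total coefficient is a sum over \<open>j\<close> whose
  consecutive terms have the ratio of those of the very-well-poised series. Uniqueness follows by
  evaluating at \<open>x = c + 1/c\<close>, where \<open>h_l(x;c)\<close> vanishes for \<open>l > 0\<close>, and dividing by the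
  common factor.
\<close>

section \<open>Shifted factorials\<close>

lemma qpoch_0 [simp]: "qpoch a q 0 = 1"
  by (simp add: qpoch_def)

lemma qpoch_Suc: "qpoch a q (Suc n) = qpoch a q n * (1 - a * q ^ n)"
  by (simp add: qpoch_def)

lemma qpoch_Suc_shift: "qpoch a q (Suc n) = (1 - a) * qpoch (a * q) q n"
  by (simp only: qpoch_def prod.lessThan_Suc_shift) (simp add: mult_ac)

lemma qpoch_add: "qpoch a q (m + n) = qpoch a q m * qpoch (a * q ^ m) q n"
  by (induction n) (simp_all add: qpoch_Suc power_add mult_ac)

lemma qpoch_shift: "qpoch a q n * (1 - a * q ^ n) = (1 - a) * qpoch (a * q) q n"
  by (simp flip: qpoch_Suc qpoch_Suc_shift)

lemma qpoch_conv_shift: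
  "1 - a * q ^ n \<noteq> 0 \<Longrightarrow> qpoch a q n = qpoch (a * q) q n * ((1 - a) / (1 - a * q ^ n))"
  using qpoch_shift[of a q n] by (simp add: nonzero_eq_divide_eq mult.commute)

lemma qpoch_eq_0_iff: "qpoch a q n = 0 \<longleftrightarrow> (\<exists>j<n. a * q ^ j = 1)"
  by (auto simp: qpoch_def)

lemma qpoch_shift_homogeneous:
  "c \<noteq> 0 \<Longrightarrow> (c - b) * qpoch (b / c * q) q n = (c - b * q ^ n) * qpoch (b / c) q n"
  using qpoch_shift[of "b / c" q n] by (simp add: field_simps)

lemma qpoch_well_poised:
  assumes "q \<noteq> 0" "b \<noteq> 0" "c \<noteq> 0"
  shows "(c - b) * (qpoch (b / c * q) q l * qpoch (c / b * q) q m) =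
    (c * q ^ m - b * q ^ l) * (q ^ (l * m) * qpoch (b / c / q ^ m) q l * qpoch (c / b / q ^ l) q m)"
proof (induction m)
  case 0
  show ?case
    using qpoch_shift_homogeneous[OF assms(3)] by simp
next
  case (Suc m)
  let ?B = "qpoch (b / c / q ^ m) q l" and ?C = "qpoch (c / b / q ^ l) q m"
  have shift: "(c * q ^ Suc m - b * q ^ l) * qpoch (b / c / q ^ Suc m) q l =
      (c * q ^ Suc m - b) * ?B"
    using qpoch_shift_homogeneous[of "c * q ^ Suc m" b q l] assms by simp
  have reflect: "(c * q ^ Suc m - b) * q ^ l * (1 - c / b / q ^ l * q ^ m) =
      (1 - c / b * q * q ^ m) * (c * q ^ m - b * q ^ l)"
    using assms by (simp add: field_simps)
  have "(c * q ^ Suc m - b * q ^ l) *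
      (q ^ (l * Suc m) * qpoch (b / c / q ^ Suc m) q l * qpoch (c / b / q ^ l) q (Suc m)) =
    (c * q ^ Suc m - b * q ^ l) * qpoch (b / c / q ^ Suc m) q l *
      (q ^ l * q ^ (l * m) * (?C * (1 - c / b / q ^ l * q ^ m)))"
    by (simp add: qpoch_Suc power_add mult_ac)
  also have "\<dots> = ((c * q ^ Suc m - b) * q ^ l * (1 - c / b / q ^ l * q ^ m)) *
      (q ^ (l * m) * ?B * ?C)"
    unfolding shift by (simp only: mult_ac)
  also have "\<dots> = (1 - c / b * q * q ^ m) * ((c * q ^ m - b * q ^ l) * (q ^ (l * m) * ?B * ?C))"
    unfolding reflect by (simp only: mult_ac)
  also have "\<dots> = (c - b) * (qpoch (b / c * q) q l * qpoch (c / b * q) q (Suc m))"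
    unfolding Suc[symmetric] qpoch_Suc by (simp only: mult_ac)
  finally show ?case ..
qed

section \<open>The polynomials $h_n$\<close>

definition h_linear :: "complex \<Rightarrow> complex poly" where
  "h_linear y = [:1 + y\<^sup>2, - y:]"

lemma h_poly_0 [simp]: "h_poly 0 a q = 1"
  by (simp add: h_poly_def)

lemma h_poly_Suc: "h_poly (Suc n) a q = h_poly n a q * h_linear (a * q ^ n)"
  by (simp add: h_poly_def h_linear_def power_mult_distrib power_even_eq del: mult_pCons_right)

lemma h_poly_add: "h_poly (m + n) a q = h_poly m a q * h_poly n (a * q ^ m) q"
  by (induction n) (simp_all add: h_poly_Suc power_add mult_ac)

lemma h_poly_Suc_shift: "h_poly (Suc n) a q = h_linear a * h_poly n (a * q) q"
  using h_poly_add[of 1 n a q] by (simp add: h_poly_Suc)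

lemma poly_h_linear_Joukowski:
  assumes "y \<noteq> 0"
  shows "poly (h_linear a) (y + 1 / y) = (1 - a * y) * (1 - a / y)"
  using assms by (simp add: h_linear_def field_simps power2_eq_square)

lemma poly_h_poly_Joukowski:
  assumes "y \<noteq> 0"
  shows "poly (h_poly n a q) (y + 1 / y) = qpoch (a * y) q n * qpoch (a / y) q n"
  by (induction n) (simp_all add: h_poly_Suc qpoch_Suc poly_h_linear_Joukowski[OF assms] mult_ac)

definition h_weight :: "complex \<Rightarrow> complex \<Rightarrow> complex \<Rightarrow> complex" where
  "h_weight x y z = (1 - x * z) * (z - x) / ((z - y) * (1 - y * z))"

lemma h_linear_decompose:
  assumes "y \<noteq> z" "y * z \<noteq> 1"
  shows "h_linear x = smult (h_weight x y z) (h_linear y) + smult (h_weight x z y) (h_linear z)"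
proof -
  define D where "D = (z - y) * (1 - y * z)"
  have "(y - z) * (1 - z * y) = - D"
    by (simp add: D_def algebra_simps)
  then have weights: "h_weight x y z = (1 - x * z) * (z - x) / D"
    "h_weight x z y = - ((1 - x * y) * (y - x) / D)"
    by (simp_all add: h_weight_def D_def)
  have "D \<noteq> 0"
    using assms by (simp add: D_def)
  then have combine: "t = P / D * r + - (Q / D) * s" if "t * D = P * r - Q * s" for t r s P Q
    using that by (simp add: field_simps)
  have "(1 + x\<^sup>2) * D = ((1 - x * z) * (z - x)) * (1 + y\<^sup>2) - ((1 - x * y) * (y - x)) * (1 + z\<^sup>2)"
    "- x * D = ((1 - x * z) * (z - x)) * - y - ((1 - x * y) * (y - x)) * - z"
    unfolding D_def by algebra+
  from this[THEN combine] show ?thesis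
    unfolding h_linear_def weights by simp
qed

section \<open>Genericity of the parameters\<close>

definition generic_pair :: "nat \<Rightarrow> complex \<Rightarrow> complex \<Rightarrow> complex \<Rightarrow> bool" where
  "generic_pair n q x y \<longleftrightarrow> x \<noteq> 0 \<and> y \<noteq> 0 \<and>
     (\<forall>j\<le>n. x * y * q ^ j \<noteq> 1) \<and> (\<forall>i\<le>n. \<forall>j\<le>n. x * q ^ i \<noteq> y * q ^ j)"

lemma generic_pair_commute: "generic_pair n q x y \<longleftrightarrow> generic_pair n q y x"
  unfolding generic_pair_def by (metis mult.commute)

lemma generic_pair_mono: "generic_pair n q x y \<Longrightarrow> m \<le> n \<Longrightarrow> generic_pair m q x y"
  by (simp add: generic_pair_def)

lemma generic_pair_shift:
  assumes "generic_pair n q x y" "q \<noteq> 0" "i \<le> n"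
  shows "generic_pair (n - i) q x (y * q ^ i)"
  using assms by (simp add: generic_pair_def mult.assoc flip: power_add)

lemma generic_pairD:
  assumes "generic_pair n q x y" "j \<le> n"
  shows "1 - x * y * q ^ j \<noteq> 0" "1 - x / y * q ^ j \<noteq> 0" "1 - y / x * q ^ j \<noteq> 0"
proof -
  have "x \<noteq> 0" "y \<noteq> 0" "x * y * q ^ j \<noteq> 1" "x * q ^ j \<noteq> y * q ^ 0" "x * q ^ 0 \<noteq> y * q ^ j"
    using assms unfolding generic_pair_def by blast+
  then show "1 - x * y * q ^ j \<noteq> 0" "1 - x / y * q ^ j \<noteq> 0" "1 - y / x * q ^ j \<noteq> 0"
    by (auto simp: field_simps)
qed

lemma generic_pair_power_neq:
  "generic_pair n q x y \<Longrightarrow> i \<le> n \<Longrightarrow> j \<le> n \<Longrightarrow> x * q ^ i \<noteq> y * q ^ j"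
  by (simp add: generic_pair_def)

lemma generic_pair_qpoch_nonzero:
  assumes "generic_pair n q x y" "m \<le> Suc n"
  shows "qpoch (x * y) q m \<noteq> 0" "qpoch (x / y) q m \<noteq> 0" "qpoch (y / x) q m \<noteq> 0"
  using generic_pairD[OF assms(1)] assms(2) by (auto simp: qpoch_eq_0_iff)

locale generic_triple =
  fixes n :: nat and q a b c :: complex
  assumes q_nonzero: "q \<noteq> 0"
    and q_power_neq_1: "\<And>j. j < n \<Longrightarrow> q ^ Suc j \<noteq> 1"
    and generic_ab: "generic_pair n q a b"
    and generic_ac: "generic_pair n q a c"
    and generic_bc: "generic_pair n q b c"
begin

lemma nonzero: "a \<noteq> 0" "b \<noteq> 0" "c \<noteq> 0"
  using generic_ab generic_bc by (auto simp: generic_pair_def)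

lemma qpoch_q_nonzero: "m \<le> n \<Longrightarrow> qpoch q q m \<noteq> 0"
  using q_power_neq_1 by (auto simp: qpoch_eq_0_iff)

lemma one_minus_q_power_nonzero: "j < n \<Longrightarrow> 1 - q ^ Suc j \<noteq> 0"
  using q_power_neq_1 by simp

lemma one_minus_mult_q_power_nonzero:
  assumes "j \<le> n"
  shows "1 - a * b * q ^ j \<noteq> 0" "1 - a * c * q ^ j \<noteq> 0" "1 - b * c * q ^ j \<noteq> 0"
    "1 - a / b * q ^ j \<noteq> 0" "1 - a / c * q ^ j \<noteq> 0" "1 - b / c * q ^ j \<noteq> 0" "1 - c / b * q ^ j \<noteq> 0"
  using generic_pairD[OF generic_ab assms] generic_pairD[OF generic_ac assms]
    generic_pairD[OF generic_bc assms] by simp_all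

lemma power_diff_nonzero: "i \<le> n \<Longrightarrow> j \<le> n \<Longrightarrow> c * q ^ i - b * q ^ j \<noteq> 0"
  using generic_pair_power_neq[OF generic_bc, of j i] by simp

end

lemma generic_triple_commute: "generic_triple n q a b c \<Longrightarrow> generic_triple n q a c b"
  using generic_pair_commute by (auto simp: generic_triple_def)

lemma generic_triple_shift:
  assumes "generic_triple n q a b c" "i \<le> n"
  shows "generic_triple (n - i) q a (b * q ^ i) c"
proof -
  interpret generic_triple n q a b c
    by fact
  have "generic_pair (n - i) q c (b * q ^ i)"
    using generic_pair_shift[of n q c b i] generic_bc q_nonzero assms(2)
    by (simp add: generic_pair_commute)
  then show ?thesis
    using generic_pair_shift[OF generic_ab q_nonzero assms(2)]
      generic_pair_mono[OF generic_ac, of "n - i"] q_nonzero q_power_neq_1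
    by unfold_locales (simp_all add: generic_pair_commute)
qed

section \<open>The binomial expansion of $h_n$\<close>

definition h_binom_total :: "complex \<Rightarrow> complex \<Rightarrow> complex \<Rightarrow> complex \<Rightarrow> nat \<Rightarrow> complex" where
  "h_binom_total a b c q n =
     qpoch q q n * qpoch (a * b) q n * qpoch (a * c) q n / qpoch (b * c) q n"

definition h_binom_side :: "complex \<Rightarrow> complex \<Rightarrow> complex \<Rightarrow> complex \<Rightarrow> nat \<Rightarrow> complex" where
  "h_binom_side a b c q n =
     qpoch (a / c) q n / (qpoch q q n * qpoch (a * b) q n * qpoch (b / c * q) q n)"

text \<open>
  Apart from the linear factor, the dependence on \<open>l\<close>, \<open>m\<close> and \<open>l + m\<close> separates, and the
  symmetry under exchanging \<open>(b, l)\<close> and \<open>(c, m)\<close> is manifest.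
\<close>
definition h_binom :: "complex \<Rightarrow> complex \<Rightarrow> complex \<Rightarrow> complex \<Rightarrow> nat \<Rightarrow> nat \<Rightarrow> complex" where
  "h_binom a b c q l m = h_binom_total a b c q (l + m) * ((c * q ^ m - b * q ^ l) / (c - b)) *
     h_binom_side a b c q l * h_binom_side a c b q m"

lemma h_binom_commute: "h_binom a b c q l m = h_binom a c b q m l"
proof -
  have "(c * q ^ m - b * q ^ l) / (c - b) = (b * q ^ l - c * q ^ m) / (b - c)"
    using minus_divide_divide[of "c * q ^ m - b * q ^ l" "c - b"] by simp
  then show ?thesis
    by (simp add: h_binom_def h_binom_total_def add.commute mult_ac)
qed

lemma h_binom_total_Suc:
  "h_binom_total a b c q (Suc n) = h_binom_total a b c q n *
     ((1 - q ^ Suc n) * (1 - a * b * q ^ n) * (1 - a * c * q ^ n) / (1 - b * c * q ^ n))"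
  by (simp add: h_binom_total_def qpoch_Suc)

lemma h_binom_side_Suc:
  "h_binom_side a b c q (Suc n) = h_binom_side a b c q n *
     ((1 - a / c * q ^ n) / ((1 - q ^ Suc n) * (1 - a * b * q ^ n) * (1 - b / c * q ^ Suc n)))"
  by (simp add: h_binom_side_def qpoch_Suc mult.assoc)

lemma h_binom_Suc:
  assumes "c * q ^ m - b * q ^ l \<noteq> 0"
  shows "h_binom a b c q (Suc l) m = h_binom a b c q l m *
    ((1 - q ^ Suc (l + m)) * (1 - a * b * q ^ (l + m)) * (1 - a * c * q ^ (l + m)) /
      (1 - b * c * q ^ (l + m))) *
    ((c * q ^ m - b * q ^ Suc l) / (c * q ^ m - b * q ^ l)) *
    ((1 - a / c * q ^ l) / ((1 - q ^ Suc l) * (1 - a * b * q ^ l) * (1 - b / c * q ^ Suc l)))"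
  using assms unfolding h_binom_def add_Suc h_binom_total_Suc h_binom_side_Suc
  by (simp add: mult_ac)

text \<open>
  The fraction of the coefficient at \<open>(l, m)\<close> that comes from \<open>(l - 1, m)\<close>. It vanishes at
  \<open>l = 0\<close>, which makes the boundary cases of Pascal's rule automatic.
\<close>
definition pascal_share :: "complex \<Rightarrow> complex \<Rightarrow> complex \<Rightarrow> complex \<Rightarrow> nat \<Rightarrow> nat \<Rightarrow> complex" where
  "pascal_share a b c q l m =
     q ^ m * (1 - q ^ l) * (c - b * q ^ l) *
       (1 - a / q * b * q ^ l) * (1 - a / q * c * q ^ (l + m) * q ^ m) /
     ((c * q ^ m - b * q ^ l) * (1 - q ^ (l + m)) *
       (1 - a / q * b * q ^ (l + m)) * (1 - a / q * c * q ^ (l + m)))"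

lemma pascal_share_0 [simp]: "pascal_share a b c q 0 m = 0"
  by (simp add: pascal_share_def)

context generic_triple
begin

lemma pascal_share_add:
  assumes "0 < l + m" "l + m \<le> n"
  shows "pascal_share a b c q l m + pascal_share a c b q m l = 1"
proof -
  define p u v where "p = a / q" and "u = q ^ l" and "v = q ^ m"
  define D where "D = (c * v - b * u) * (1 - u * v) * (1 - p * b * (u * v)) * (1 - p * c * (u * v))"
  obtain i where sum_eq: "l + m = Suc i"
    using assms(1) gr0_conv_Suc by blast
  have "1 - q ^ (l + m) \<noteq> 0" "1 - p * b * q ^ (l + m) \<noteq> 0" "1 - p * c * q ^ (l + m) \<noteq> 0"
    using one_minus_q_power_nonzero[of i] one_minus_mult_q_power_nonzero(1,2)[of i] assms(2)
      q_nonzero unfolding sum_eq p_def by (simp_all add: mult.assoc)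
  then have "D \<noteq> 0"
    using power_diff_nonzero[of m l] assms(2) by (simp add: D_def u_def v_def power_add)
  moreover have "pascal_share a b c q l m =
      v * (1 - u) * (c - b * u) * (1 - p * b * u) * (1 - p * c * (u * v) * v) / D"
    by (simp add: pascal_share_def p_def u_def v_def D_def power_add)
  moreover have "pascal_share a c b q m l =
      - (u * (1 - v) * (b - c * v) * (1 - p * c * v) * (1 - p * b * (u * v) * u)) / D"
  proof -
    have "(b * u - c * v) * (1 - u * v) * (1 - p * c * (u * v)) * (1 - p * b * (u * v)) = - D"
      unfolding D_def by algebra
    then show ?thesis
      by (simp add: pascal_share_def p_def u_def v_def power_add mult.commute[of "q ^ m" "q ^ l"])
  qed
  moreover have "v * (1 - u) * (c - b * u) * (1 - p * b * u) * (1 - p * c * (u * v) * v) -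
      u * (1 - v) * (b - c * v) * (1 - p * c * v) * (1 - p * b * (u * v) * u) = D"
    unfolding D_def by algebra
  ultimately show ?thesis
    by (simp flip: diff_divide_distrib)
qed

lemma h_binom_mult_pascal_share:
  assumes "l + m < n"
  shows "h_binom a b c q (Suc l) m * pascal_share a b c q (Suc l) m =
    h_binom a b c q l m * h_weight (a * q ^ (l + m)) (b * q ^ l) (c * q ^ m)"
proof -
  define T where "T = 1 - a * c * q ^ (l + m) * q ^ m"
  define L L' where "L = c * q ^ m - b * q ^ l" and "L' = c * q ^ m - b * q ^ Suc l"
  have nonvanishing: "L \<noteq> 0" "L' \<noteq> 0" "1 - q ^ Suc l \<noteq> 0" "1 - q ^ Suc (l + m) \<noteq> 0"
    "1 - a * b * q ^ l \<noteq> 0" "1 - a * b * q ^ (l + m) \<noteq> 0" "1 - a * c * q ^ (l + m) \<noteq> 0"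
    "1 - b / c * q ^ Suc l \<noteq> 0"
    unfolding L_def L'_def
    by (rule power_diff_nonzero one_minus_q_power_nonzero one_minus_mult_q_power_nonzero;
      use assms in simp)+
  have share: "pascal_share a b c q (Suc l) m =
      q ^ m * (1 - q ^ Suc l) * (c * (1 - b / c * q ^ Suc l)) * (1 - a * b * q ^ l) * T /
      (L' * (1 - q ^ Suc (l + m)) * (1 - a * b * q ^ (l + m)) * (1 - a * c * q ^ (l + m)))"
    using q_nonzero nonzero
    by (simp add: pascal_share_def T_def L'_def right_diff_distrib mult.assoc)
  have "c * q ^ m - a * q ^ (l + m) = c * q ^ m * (1 - a / c * q ^ l)"
    using nonzero by (simp add: power_add field_simps)
  then have weight: "h_weight (a * q ^ (l + m)) (b * q ^ l) (c * q ^ m) =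
      T * (c * q ^ m * (1 - a / c * q ^ l)) / (L * (1 - b * c * q ^ (l + m)))"
    by (simp add: h_weight_def T_def L_def power_add mult_ac)
  have "h_binom a b c q (Suc l) m = h_binom a b c q l m *
    ((1 - q ^ Suc (l + m)) * (1 - a * b * q ^ (l + m)) * (1 - a * c * q ^ (l + m)) /
      (1 - b * c * q ^ (l + m))) * (L' / L) *
    ((1 - a / c * q ^ l) / ((1 - q ^ Suc l) * (1 - a * b * q ^ l) * (1 - b / c * q ^ Suc l)))"
    using nonvanishing(1) unfolding L_def L'_def by (rule h_binom_Suc)
  then show ?thesis
    unfolding share weight using nonvanishing nonzero by (simp add: mult_ac del: power_Suc)
qed

lemma h_binom_mult_h_linear:
  assumes "l + m < n"
  defines "C \<equiv> h_binom a b c q" and "H \<equiv> \<lambda>l m. h_poly l b q * h_poly m c q"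
  shows "smult (C l m) (H l m) * h_linear (a * q ^ (l + m)) =
    smult (C (Suc l) m * pascal_share a b c q (Suc l) m) (H (Suc l) m) +
    smult (C l (Suc m) * pascal_share a c b q (Suc m) l) (H l (Suc m))"
proof -
  interpret swap: generic_triple n q a c b
    by (rule generic_triple_commute) unfold_locales
  let ?x = "a * q ^ (l + m)" and ?y = "b * q ^ l" and ?z = "c * q ^ m"
  have distinct: "?y \<noteq> ?z" "?y * ?z \<noteq> 1"
    using generic_bc assms(1) by (simp_all add: generic_pair_def power_add[symmetric] mult_ac)
  have "smult (C l m) (H l m) * h_linear ?x =
      smult (C l m * h_weight ?x ?y ?z) (H l m * h_linear ?y) +
      smult (C l m * h_weight ?x ?z ?y) (H l m * h_linear ?z)"
    by (simp only: h_linear_decompose[OF distinct, of ?x] distrib_left mult_smult_left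
        mult_smult_right smult_add_right smult_smult mult.commute[of "C l m"])
  also have "C l m * h_weight ?x ?y ?z = C (Suc l) m * pascal_share a b c q (Suc l) m"
    using h_binom_mult_pascal_share[OF assms(1)] by (simp add: C_def)
  also have "C l m * h_weight ?x ?z ?y = C l (Suc m) * pascal_share a c b q (Suc m) l"
    using swap.h_binom_mult_pascal_share[of m l] assms(1)
    by (simp add: C_def h_binom_commute[of a b] add.commute)
  also have "H l m * h_linear ?y = H (Suc l) m"
    by (simp add: H_def h_poly_Suc mult_ac)
  also have "H l m * h_linear ?z = H l (Suc m)"
    by (simp add: H_def h_poly_Suc mult_ac)
  finally show ?thesis .
qed

theorem h_poly_binomial:
  "i \<le> n \<Longrightarrow> h_poly i a q =
     (\<Sum>l\<le>i. smult (h_binom a b c q l (i - l)) (h_poly l b q * h_poly (i - l) c q))"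
proof (induction i)
  case 0
  have "b \<noteq> c"
    using generic_pair_power_neq[OF generic_bc, of 0 0] by simp
  then show ?case
    by (simp add: h_binom_def h_binom_total_def h_binom_side_def)
next
  case (Suc i)
  let ?C = "h_binom a b c q" and ?H = "\<lambda>l m. h_poly l b q * h_poly m c q"
  define F where "F l m = smult (?C l m * pascal_share a b c q l m) (?H l m)" for l m
  define G where "G l m = smult (?C l m * pascal_share a c b q m l) (?H l m)" for l m
  have boundary: "F 0 m = 0" "G l 0 = 0" for l m
    by (simp_all add: F_def G_def)
  have "h_poly (Suc i) a q = (\<Sum>l\<le>i. smult (?C l (i - l)) (?H l (i - l)) * h_linear (a * q ^ i))"
    using Suc by (simp only: h_poly_Suc sum_distrib_right)
  also have "\<dots> = (\<Sum>l\<le>i. F (Suc l) (i - l) + G l (Suc i - l))"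
  proof (intro sum.cong refl)
    fix l assume "l \<in> {..i}"
    then show "smult (?C l (i - l)) (?H l (i - l)) * h_linear (a * q ^ i) =
        F (Suc l) (i - l) + G l (Suc i - l)"
      using h_binom_mult_h_linear[of l "i - l"] Suc.prems by (simp add: F_def G_def Suc_diff_le)
  qed
  also have "\<dots> = (\<Sum>l\<le>Suc i. F l (Suc i - l)) + (\<Sum>l\<le>Suc i. G l (Suc i - l))"
    by (simp add: sum.distrib sum.atMost_Suc_shift[of "\<lambda>l. F l (Suc i - l)"]
        sum.atMost_Suc[of "\<lambda>l. G l (Suc i - l)"] boundary del: sum.atMost_Suc)
  also have "\<dots> = (\<Sum>l\<le>Suc i. smult (?C l (Suc i - l)) (?H l (Suc i - l)))"
    unfolding sum.distrib[symmetric]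
  proof (intro sum.cong refl)
    fix l assume "l \<in> {..Suc i}"
    then have "pascal_share a b c q l (Suc i - l) + pascal_share a c b q (Suc i - l) l = 1"
      using Suc.prems by (intro pascal_share_add) auto
    then show "F l (Suc i - l) + G l (Suc i - l) = smult (?C l (Suc i - l)) (?H l (Suc i - l))"
      by (simp only: F_def G_def smult_add_left[symmetric] distrib_left[symmetric] mult_1_right)
  qed
  finally show ?case .
qed

theorem h_poly_mult_expansion:
  assumes "j \<le> n"
  shows "h_poly j b q * h_poly (n - j) a q =
    (\<Sum>l=j..n. smult (h_binom a (b * q ^ j) c q (l - j) (n - l))
      (h_poly l b q * h_poly (n - l) c q))"
proof -
  interpret shifted: generic_triple "n - j" q a "b * q ^ j" c
    using generic_triple_axioms assms by (rule generic_triple_shift)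
  have "h_poly j b q * h_poly (n - j) a q = (\<Sum>i\<le>n - j.
      smult (h_binom a (b * q ^ j) c q i (n - j - i))
        (h_poly (j + i) b q * h_poly (n - (j + i)) c q))"
    by (simp add: shifted.h_poly_binomial[OF order_refl] h_poly_add sum_distrib_left mult.assoc)
  also have "\<dots> = (\<Sum>l=j..n.
      smult (h_binom a (b * q ^ j) c q (l - j) (n - l)) (h_poly l b q * h_poly (n - l) c q))"
    by (rule sum.reindex_bij_witness[of _ "\<lambda>l. l - j" "\<lambda>i. j + i"]) (use assms in auto)
  finally show ?thesis .
qed

end

section \<open>Linear independence\<close>

lemma h_poly_products_independent:
  assumes "generic_pair n q c d" "q \<noteq> 0"
    and "(\<Sum>l\<le>n. smult (r l) (h_poly l c q * h_poly (n - l) d q)) = 0"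
    and "l \<le> n"
  shows "r l = 0"
  using assms
proof (induction n arbitrary: c r l)
  case 0
  then show ?case by simp
next
  case (Suc n)
  let ?tail = "\<Sum>l\<le>n. smult (r (Suc l)) (h_poly l (c * q) q * h_poly (n - l) d q)"
  have c_nonzero: "c \<noteq> 0"
    using Suc.prems(1) by (simp add: generic_pair_def)
  have peel: "smult (r 0) (h_poly (Suc n) d q) + h_linear c * ?tail = 0"
    using Suc.prems(3)
    by (simp only: sum.atMost_Suc_shift h_poly_Suc_shift[of _ c] sum_distrib_left mult_smult_right
        mult.assoc h_poly_0 diff_zero diff_Suc_Suc mult_1)
  have "poly (smult (r 0) (h_poly (Suc n) d q) + h_linear c * ?tail) (c + 1 / c) = 0"
    unfolding peel by simp
  then have "r 0 * (qpoch (d * c) q (Suc n) * qpoch (d / c) q (Suc n)) = 0"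
    using c_nonzero by (simp add: poly_h_linear_Joukowski poly_h_poly_Joukowski)
  then have r_0: "r 0 = 0"
    using generic_pair_qpoch_nonzero[OF Suc.prems(1), of "Suc n"] by (simp add: mult.commute[of d])
  have "h_linear c \<noteq> 0"
    using c_nonzero by (simp add: h_linear_def)
  then have tail: "?tail = 0"
    using peel by (simp add: r_0)
  have "generic_pair n q (c * q) d"
    using generic_pair_shift[of "Suc n" q d c 1] Suc.prems(1,2) by (simp add: generic_pair_commute)
  then have "r (Suc i) = 0" if "i \<le> n" for i
    using Suc.IH[of "c * q" "\<lambda>l. r (Suc l)" i] Suc.prems(2) tail that by simp
  with r_0 Suc.prems(4) show ?case
    by (cases l) auto
qed

section \<open>Closed form and ratios of the expansion coefficients\<close>

context generic_triple
begin

lemma h_binom_eq_qbinom: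
  assumes "l + m \<le> n"
  shows "h_binom a b c q l m = qbinom (l + m) l q *
    (qpoch (a / c) q l * qpoch (a * c * q ^ m) q l *
      qpoch (a / b) q m * qpoch (a * b * q ^ l) q m) /
    (q ^ (l * m) * qpoch (b * c) q (l + m) * qpoch (b / c / q ^ m) q l * qpoch (c / b / q ^ l) q m)"
proof -
  let ?D = "qpoch (b / c * q) q l * qpoch (c / b * q) q m"
  have "c * q ^ m - b * q ^ l \<noteq> 0"
    using assms by (intro power_diff_nonzero) auto
  then have linear: "(c * q ^ m - b * q ^ l) / ((c - b) * ?D) =
      1 / (q ^ (l * m) * qpoch (b / c / q ^ m) q l * qpoch (c / b / q ^ l) q m)"
    unfolding qpoch_well_poised[OF q_nonzero nonzero(2,3)] by simp
  have split: "qpoch (a * b) q (l + m) = qpoch (a * b) q l * qpoch (a * b * q ^ l) q m"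
    "qpoch (a * c) q (l + m) = qpoch (a * c) q m * qpoch (a * c * q ^ m) q l"
    using qpoch_add[of "a * c" q m l] by (simp_all add: qpoch_add add.commute)
  have nonvanishing: "qpoch (a * b) q l \<noteq> 0" "qpoch (a * c) q m \<noteq> 0"
    using generic_pair_qpoch_nonzero(1)[OF generic_ab, of l]
      generic_pair_qpoch_nonzero(1)[OF generic_ac, of m] assms by simp_all
  have "h_binom a b c q l m = (c * q ^ m - b * q ^ l) / ((c - b) * ?D) *
    (qpoch q q (l + m) * qpoch (a * b) q (l + m) * qpoch (a * c) q (l + m) /
      qpoch (b * c) q (l + m)) *
    (qpoch (a / c) q l / (qpoch q q l * qpoch (a * b) q l)) *
    (qpoch (a / b) q m / (qpoch q q m * qpoch (a * c) q m))"
    by (simp add: h_binom_def h_binom_total_def h_binom_side_def mult_ac)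
  then show ?thesis
    unfolding linear split qbinom_def using nonvanishing by (simp add: mult_ac)
qed

lemma h_binom_exchange:
  assumes "l + m < n"
  shows "h_binom a b c q l (Suc m) = h_binom a b c q (Suc l) m *
    ((c * q ^ Suc m - b * q ^ l) / (c * q ^ m - b * q ^ Suc l)) *
    ((1 - b / c * q ^ Suc l) / (1 - q ^ Suc m)) * ((1 - q ^ Suc l) / (1 - c / b * q ^ Suc m)) *
    ((1 - a / b * q ^ m) / (1 - a / c * q ^ l)) * ((1 - a * b * q ^ l) / (1 - a * c * q ^ m))"
proof -
  have nonvanishing: "c * q ^ m - b * q ^ Suc l \<noteq> 0" "1 - q ^ Suc l \<noteq> 0" "1 - a * b * q ^ l \<noteq> 0"
    "1 - b / c * q ^ Suc l \<noteq> 0" "1 - a / c * q ^ l \<noteq> 0"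
    by (rule power_diff_nonzero one_minus_q_power_nonzero one_minus_mult_q_power_nonzero;
      use assms in simp)+
  show ?thesis
    unfolding h_binom_def add_Suc add_Suc_right h_binom_side_Suc
    using nonvanishing nonzero by (simp add: mult_ac del: power_Suc)
qed

lemma h_binom_total_shift:
  assumes "m < n"
  shows "h_binom_total a (b * q) c q m = h_binom_total a b c q (Suc m) *
    ((1 - b * c) / ((1 - q ^ Suc m) * (1 - a * b) * (1 - a * c * q ^ m)))"
proof -
  have "1 - a * b \<noteq> 0" "1 - b * c \<noteq> 0" "1 - a * c * q ^ m \<noteq> 0" "1 - q ^ Suc m \<noteq> 0"
    using one_minus_mult_q_power_nonzero[of 0] one_minus_mult_q_power_nonzero(2)[of m]
      one_minus_q_power_nonzero[of m] assms by simp_all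
  then show ?thesis
    unfolding h_binom_total_def qpoch_Suc_shift[of "a * b"] qpoch_Suc_shift[of "b * c"]
      qpoch_Suc[of q] qpoch_Suc[of "a * c"] by (simp add: mult_ac)
qed

lemma h_binom_side_shift_left:
  assumes "m < n"
  shows "h_binom_side a (b * q) c q m = h_binom_side a b c q (Suc m) *
    ((1 - q ^ Suc m) * (1 - a * b) * (1 - b / c * q) / (1 - a / c * q ^ m))"
proof -
  have "1 - a * b \<noteq> 0" "1 - b / c * q \<noteq> 0" "1 - a / c * q ^ m \<noteq> 0" "1 - q ^ Suc m \<noteq> 0"
    using one_minus_mult_q_power_nonzero[of 0] one_minus_mult_q_power_nonzero(6)[of 1]
      one_minus_mult_q_power_nonzero(5)[of m] one_minus_q_power_nonzero[of m] assms by simp_all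
  then show ?thesis
    unfolding h_binom_side_def qpoch_Suc_shift[of "a * b"] qpoch_Suc_shift[of "b / c * q"]
      qpoch_Suc[of q] qpoch_Suc[of "a / c"] using nonzero by (simp add: mult_ac)
qed

lemma h_binom_side_shift_right:
  assumes "m < n"
  shows "h_binom_side a c (b * q) q m = h_binom_side a c b q m *
    ((1 - a / (b * q)) / (1 - a / (b * q) * q ^ m)) * ((1 - c / b * q ^ m) / (1 - c / b))"
proof -
  have "1 - c / b * q ^ m \<noteq> 0" "1 - a / (b * q) * q ^ m \<noteq> 0"
    using one_minus_mult_q_power_nonzero(7)[of m] generic_pair_power_neq[OF generic_ab, of m 1]
      assms q_nonzero nonzero by (simp_all add: field_simps)
  then show ?thesis
    using q_nonzero
    by (simp add: h_binom_side_def qpoch_conv_shift[of "a / (b * q)"] qpoch_conv_shift[of "c / b"])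
qed

lemma h_binom_shift:
  assumes "l + m < n"
  shows "h_binom a (b * q) c q l m = h_binom a b c q (Suc l) m *
    ((1 - b * c) / (1 - a * c * q ^ (l + m))) * ((1 - q ^ Suc l) / (1 - a / (b * q) * q ^ m)) *
    ((q ^ m - b / c) / (1 - a / c * q ^ l)) * ((1 - a / (b * q)) / (1 - q ^ Suc (l + m)))"
proof -
  have nonvanishing: "1 - a * b \<noteq> 0" "c - b \<noteq> 0" "c - b * q \<noteq> 0"
    using one_minus_mult_q_power_nonzero(1)[of 0] power_diff_nonzero[of 0 0]
      power_diff_nonzero[of 0 1] assms by simp_all
  have "1 - b / c * q = (c - b * q) / c" "1 - c / b = - ((c - b) / b)"
    "1 - c / b * q ^ m = - (c / b * (q ^ m - b / c))"
    using nonzero by (simp_all add: field_simps)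
  then have linear:
    "(c - b) / (c - b * q) * (1 - b / c * q) * ((1 - c / b * q ^ m) / (1 - c / b)) = q ^ m - b / c"
    using nonvanishing nonzero by simp
  have "h_binom a (b * q) c q l m = h_binom_total a b c q (Suc (l + m)) *
    ((c * q ^ m - b * q ^ Suc l) / (c - b)) *
    h_binom_side a b c q (Suc l) * h_binom_side a c b q m *
    ((1 - b * c) / (1 - a * c * q ^ (l + m))) * ((1 - q ^ Suc l) / (1 - a / (b * q) * q ^ m)) *
    ((c - b) / (c - b * q) * (1 - b / c * q) * ((1 - c / b * q ^ m) / (1 - c / b)) /
      (1 - a / c * q ^ l)) *
    ((1 - a / (b * q)) / (1 - q ^ Suc (l + m)))"
    using assms nonvanishing
    by (simp add: h_binom_def h_binom_total_shift h_binom_side_shift_left h_binom_side_shift_right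
        mult_ac)
  then show ?thesis
    unfolding linear by (simp only: h_binom_def add_Suc)
qed

end

section \<open>Ratios of very-well-poised terms\<close>

definition well_poised_ratio :: "complex \<Rightarrow> complex \<Rightarrow> complex \<Rightarrow> complex \<Rightarrow> complex" where
  "well_poised_ratio A q x b = (1 - b * x) / (1 - A * q / b * x)"

lemma one_minus_reflect: "z * w = 1 \<Longrightarrow> 1 - z = - z * (1 - w)" for z w :: "'a::comm_ring_1"
  by (simp add: right_diff_distrib)

lemma well_poised_ratio_reflect_denominator:
  assumes "z * (A * q / b * x) = 1"
  shows "(1 - b * x) / (1 - z) = - (A * q / b * x) * well_poised_ratio A q x b"
proof -
  have "inverse (1 - z) = inverse (- z) * inverse (1 - A * q / b * x)"
    unfolding one_minus_reflect[OF assms] by (rule inverse_mult_distrib)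
  also have "inverse (- z) = - (A * q / b * x)"
    using inverse_unique[OF assms] by simp
  finally show ?thesis
    by (simp add: well_poised_ratio_def divide_inverse mult_ac)
qed

lemma well_poised_ratio_reflect:
  assumes "w * (b * x) = 1" "z * (A * q / b * x) = 1"
  shows "(1 - w) / (1 - z) = w * (A * q / b * x) * well_poised_ratio A q x b"
proof -
  have "(1 - w) / (1 - z) = - w * ((1 - b * x) / (1 - z))"
    by (simp add: one_minus_reflect[OF assms(1)])
  then show ?thesis
    by (simp add: well_poised_ratio_reflect_denominator[OF assms(2)])
qed

lemma well_poised_ratio_reflect_numerator:
  assumes "w * (b * x) = 1"
  shows "(1 - w) / (1 - A * q / b * x) = - w * well_poised_ratio A q x b"
  by (simp add: well_poised_ratio_def one_minus_reflect[OF assms])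

lemma vwp_term_0:
  assumes "A \<noteq> 1"
  shows "vwp_term A bs q z 0 = 1"
proof -
  have "(\<Prod>b\<leftarrow>bs. 1) = (1 :: complex)"
    by (induction bs) auto
  then show ?thesis
    using assms by (simp add: vwp_term_def)
qed

lemma vwp_term_Suc:
  assumes "A \<noteq> 0" "1 - A * q ^ (2 * n) \<noteq> 0"
  shows "vwp_term A bs q z (Suc n) = vwp_term A bs q z n *
    ((1 - A * q ^ (2 * Suc n)) / (1 - A * q ^ (2 * n)) *
      (\<Prod>b\<leftarrow>A # bs. well_poised_ratio A q (q ^ n) b) * z)"
proof -
  have qpoch_prod: "(\<Prod>b\<leftarrow>bs. qpoch (f b) q (Suc n)) =
      (\<Prod>b\<leftarrow>bs. qpoch (f b) q n) * (\<Prod>b\<leftarrow>bs. 1 - f b * q ^ n)" for f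
    by (induction bs) (simp_all add: qpoch_Suc mult_ac)
  have "(\<Prod>b\<leftarrow>bs. well_poised_ratio A q (q ^ n) b) =
      (\<Prod>b\<leftarrow>bs. 1 - b * q ^ n) / (\<Prod>b\<leftarrow>bs. 1 - A * q / b * q ^ n)"
    by (induction bs) (simp_all add: well_poised_ratio_def)
  moreover have "well_poised_ratio A q (q ^ n) A = (1 - A * q ^ n) / (1 - q ^ Suc n)"
    using assms(1) by (simp add: well_poised_ratio_def)
  ultimately show ?thesis
    unfolding vwp_term_def qpoch_prod[of "\<lambda>b. b"] qpoch_prod[of "\<lambda>b. A * q / b"]
      qpoch_Suc[of A] qpoch_Suc[of q]
    using assms(2) by (simp add: mult_ac)
qed

section \<open>Composition of two expansions\<close>

lemma power_int_nat_diff: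
  fixes q :: "'a::field"
  assumes "q \<noteq> 0"
  shows "q powi (- int i) = 1 / q ^ i" "q powi (int i - int j) = q ^ i / q ^ j"
    "q powi (1 - int i) = q / q ^ i"
  using assms by (simp_all add: power_int_minus power_int_diff divide_inverse)

lemma smult_sum_right: "smult x (\<Sum>i\<in>I. p i) = (\<Sum>i\<in>I. smult x (p i))"
  by (induction I rule: infinite_finite_induct) (simp_all add: smult_add_right)

locale generic_quadruple =
  abc: generic_triple N q a b c + bcd: generic_triple N q b c d for N q a b c d
begin

definition inner_coeff :: "nat \<Rightarrow> nat \<Rightarrow> complex" where
  "inner_coeff k j = h_binom a (b * q ^ (N - k)) c q (k - j) j"

definition outer_coeff :: "nat \<Rightarrow> nat \<Rightarrow> complex" where
  "outer_coeff l j = h_binom b (c * q ^ j) d q (l - j) (N - l)"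

lemma inner_triple: "k \<le> N \<Longrightarrow> generic_triple k q a (b * q ^ (N - k)) c"
  using generic_triple_shift[OF abc.generic_triple_axioms, of "N - k"] by simp

lemma outer_triple: "j \<le> N \<Longrightarrow> generic_triple (N - j) q b (c * q ^ j) d"
  using generic_triple_shift[OF bcd.generic_triple_axioms] .

lemma h_poly_inner_expansion:
  assumes "k \<le> N"
  shows "h_poly k a q * h_poly (N - k) b q =
    (\<Sum>j\<le>k. smult (inner_coeff k j) (h_poly j c q * h_poly (N - j) b q))"
proof -
  have "h_poly k a q * h_poly (N - k) b q = (\<Sum>i=N - k..N.
      smult (h_binom a (b * q ^ (N - k)) c q (i - (N - k)) (N - i))
        (h_poly i b q * h_poly (N - i) c q))"
    using abc.h_poly_mult_expansion[of "N - k"] assms by (simp add: mult.commute)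
  also have "\<dots> = (\<Sum>j\<le>k. smult (inner_coeff k j) (h_poly j c q * h_poly (N - j) b q))"
    by (rule sum.reindex_bij_witness[of _ "\<lambda>j. N - j" "\<lambda>i. N - i"])
      (use assms in \<open>auto simp: inner_coeff_def mult.commute add.commute\<close>)
  finally show ?thesis .
qed

lemma h_poly_product_expansion:
  assumes "k \<le> N"
  shows "h_poly k a q * h_poly (N - k) b q =
    (\<Sum>l\<le>N. smult (\<Sum>j\<le>min k l. inner_coeff k j * outer_coeff l j)
      (h_poly l c q * h_poly (N - l) d q))"
proof -
  let ?H = "\<lambda>l. h_poly l c q * h_poly (N - l) d q"
  have "h_poly k a q * h_poly (N - k) b q =
      (\<Sum>j\<le>k. \<Sum>l | l \<in> {..N} \<and> j \<le> l. smult (inner_coeff k j * outer_coeff l j) (?H l))"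
    unfolding h_poly_inner_expansion[OF assms]
  proof (intro sum.cong refl)
    fix j assume "j \<in> {..k}"
    moreover have "{l. l \<in> {..N} \<and> j \<le> l} = {j..N}"
      by auto
    ultimately show "smult (inner_coeff k j) (h_poly j c q * h_poly (N - j) b q) =
        (\<Sum>l | l \<in> {..N} \<and> j \<le> l. smult (inner_coeff k j * outer_coeff l j) (?H l))"
      using bcd.h_poly_mult_expansion[of j] assms by (simp add: outer_coeff_def smult_sum_right)
  qed
  also have "\<dots> =
      (\<Sum>l\<le>N. \<Sum>j | j \<in> {..k} \<and> j \<le> l. smult (inner_coeff k j * outer_coeff l j) (?H l))"
    by (rule sum.swap_restrict) simp_all
  also have "\<dots> = (\<Sum>l\<le>N. smult (\<Sum>j\<le>min k l. inner_coeff k j * outer_coeff l j) (?H l))"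
  proof (intro sum.cong refl)
    fix l
    have "{j. j \<in> {..k} \<and> j \<le> l} = {..min k l}"
      by auto
    then show "(\<Sum>j | j \<in> {..k} \<and> j \<le> l. smult (inner_coeff k j * outer_coeff l j) (?H l)) =
        smult (\<Sum>j\<le>min k l. inner_coeff k j * outer_coeff l j) (?H l)"
      by (simp add: smult_sum)
  qed
  finally show ?thesis .
qed

section \<open>Identification of the coefficients\<close>

lemma inner_coeff_0:
  assumes "k \<le> N"
  shows "inner_coeff k 0 = qpoch (a / c) q k * qpoch (a * c) q k /
    (qpoch (b * c * q ^ (N - k)) q k * qpoch (b / c * q ^ (N - k)) q k)"
proof -
  interpret inner: generic_triple k q a "b * q ^ (N - k)" c
    using assms by (rule inner_triple)
  show ?thesis
    using inner.h_binom_eq_qbinom[of k 0] inner.qpoch_q_nonzero[of k]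
    by (simp add: inner_coeff_def qbinom_def mult_ac)
qed

lemma outer_coeff_0:
  assumes "l \<le> N"
  shows "outer_coeff l 0 = qbinom N l q *
    (qpoch (b / d) q l * qpoch (b * d * q ^ (N - l)) q l *
      qpoch (b / c) q (N - l) * qpoch (b * c * q ^ l) q (N - l)) /
    (q ^ (l * (N - l)) * qpoch (c * d) q N *
      qpoch (c / d / q ^ (N - l)) q l * qpoch (d / c / q ^ l) q (N - l))"
  using bcd.h_binom_eq_qbinom[of l "N - l"] assms by (simp add: outer_coeff_def)

lemma inner_coeff_Suc:
  assumes "j < k" "k \<le> N"
  defines "x \<equiv> q ^ j" and "K \<equiv> q ^ k" and "M \<equiv> q ^ N"
  shows "inner_coeff k (Suc j) = inner_coeff k j *
    ((c * (q * x) - b * M / (q * x)) / (c * x - b * M / x)) *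
    ((1 - b * M / (c * x)) / (1 - q * x)) * ((1 - K / x) / (1 - c * K / (b * M) * (q * x))) *
    ((1 - a * K / (b * M) * x) / (1 - a * K / (c * q * x))) *
    ((1 - a * b * M / (q * x)) / (1 - a * c * x))"
proof -
  define B where "B = b * q ^ (N - k)"
  interpret inner: generic_triple k q a B c
    unfolding B_def using assms(2) by (rule inner_triple)
  obtain i where k_eq: "k = Suc (j + i)"
    using assms(1) less_iff_Suc_add by blast
  have nonzero: "q \<noteq> 0" "x \<noteq> 0" "K \<noteq> 0" "b \<noteq> 0"
    using abc.nonzero abc.q_nonzero by (simp_all add: x_def K_def)
  have "K = q * x * q ^ i"
    by (simp add: K_def x_def k_eq power_add)
  then have power_i: "q ^ i = K / (q * x)"
    using nonzero(1,2) by (simp only: nonzero_eq_divide_eq mult_eq_0_iff simp_thms mult.commute)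
  have B_eq: "B = b * M / K"
    using assms(2) nonzero by (simp add: B_def M_def K_def power_diff)
  have "inner_coeff k (Suc j) = h_binom a B c q i (Suc j)"
    "inner_coeff k j = h_binom a B c q (Suc i) j"
    by (simp_all add: inner_coeff_def B_def k_eq)
  moreover have "B * q ^ i = b * M / (q * x)" "B * (q * q ^ i) = b * M / x"
    "B / c * (q * q ^ i) = b * M / (c * x)" "q * q ^ i = K / x" "c / B = c * K / (b * M)"
    "a / B = a * K / (b * M)" "a / c * q ^ i = a * K / (c * q * x)"
    "a * B * q ^ i = a * b * M / (q * x)"
    using nonzero by (simp_all add: power_i B_eq)
  ultimately show ?thesis
    using inner.h_binom_exchange[of i j]
    by (simp only: k_eq less_Suc_eq_le le_refl add.commute power_Suc flip: x_def)
qed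

lemma outer_coeff_Suc:
  assumes "j < l" "l \<le> N"
  defines "x \<equiv> q ^ j" and "L \<equiv> q ^ l" and "M \<equiv> q ^ N"
  shows "outer_coeff l (Suc j) = outer_coeff l j *
    ((1 - c * d * x) / (1 - b * d * M / (q * x))) *
    ((1 - L / x) / (1 - b * M / (c * q * x * L))) *
    ((M / L - c * x / d) / (1 - b * L / (d * q * x))) * ((1 - b / (c * q * x)) / (1 - M / x))"
proof -
  interpret outer: generic_triple "N - j" q b "c * q ^ j" d
    using assms by (intro outer_triple) simp
  define m where "m = N - l"
  obtain i where l_eq: "l = Suc (j + i)"
    using assms(1) less_iff_Suc_add by blast
  have index: "i + m < N - j"
    using assms(2) by (simp add: l_eq m_def)
  have nonzero: "q \<noteq> 0" "x \<noteq> 0" "L \<noteq> 0"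
    using bcd.q_nonzero by (simp_all add: x_def L_def)
  have "L = q * x * q ^ i" "M = L * q ^ m"
    using assms(2) by (simp_all add: L_def M_def x_def m_def l_eq flip: power_add power_Suc)
  then have powers: "q ^ i = L / (q * x)" "q ^ m = M / L"
    using nonzero by (simp_all only: nonzero_eq_divide_eq mult_eq_0_iff simp_thms mult.commute)
  have "outer_coeff l (Suc j) = h_binom b (c * x * q) d q i m"
    "outer_coeff l j = h_binom b (c * x) d q (Suc i) m"
    by (simp_all add: outer_coeff_def m_def l_eq x_def mult_ac)
  moreover have "c * x * d = c * d * x" "b * d * (q ^ i * q ^ m) = b * d * M / (q * x)"
    "q * q ^ i = L / x" "b / (c * x * q) * q ^ m = b * M / (c * q * x * L)"
    "b / d * q ^ i = b * L / (d * q * x)" "b / (c * x * q) = b / (c * q * x)" "q * (q ^ i * q ^ m) = M / x"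
    using nonzero by (simp_all add: powers mult_ac)
  ultimately show ?thesis
    using outer.h_binom_shift[OF index]
    by (simp only: power_Suc power_add powers(2) flip: x_def)
qed

abbreviation W_base :: complex where
  "W_base \<equiv> c / (b * q ^ N)"

abbreviation W_params :: "nat \<Rightarrow> nat \<Rightarrow> complex list" where
  "W_params k l \<equiv> [1 / q ^ k, 1 / q ^ l, q ^ k / q ^ N * a / b, q ^ l / q ^ N * c / d, c * d,
     q / q ^ N / (a * b), q * c / b]"

lemma W_base_linear_ratio:
  "(c * (q * q ^ j) - b * q ^ N / (q * q ^ j)) / (c * q ^ j - b * q ^ N / q ^ j) =
    1 / q * ((1 - W_base * q ^ (2 * Suc j)) / (1 - W_base * q ^ (2 * j)))"
proof -
  have nonzero: "b \<noteq> 0" "q \<noteq> 0"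
    using abc.nonzero abc.q_nonzero by simp_all
  have "q ^ (2 * i) = q ^ i * q ^ i" for i
    by (simp add: mult_2 power_add)
  then have reflect: "c * q ^ i - b * q ^ N / q ^ i =
      - (b * q ^ N / q ^ i) * (1 - W_base * q ^ (2 * i))" for i
    using nonzero by (simp add: field_simps)
  show ?thesis
    using reflect[of "Suc j"] reflect[of j] nonzero by simp
qed

lemma inner_coeff_Suc_well_poised:
  assumes "j < k" "k \<le> N"
  shows "inner_coeff k (Suc j) = inner_coeff k j * (b\<^sup>2 * (q ^ N)\<^sup>2 / (q * (q ^ j)\<^sup>2)) *
    ((1 - W_base * q ^ (2 * Suc j)) / (1 - W_base * q ^ (2 * j))) *
    (\<Prod>p\<leftarrow>[W_base, 1 / q ^ k, q ^ k / q ^ N * a / b, q / q ^ N / (a * b)].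
      well_poised_ratio W_base q (q ^ j) p)"
proof -
  define x K M where "x = q ^ j" and "K = q ^ k" and "M = q ^ N"
  let ?A = "c / (b * M)"
  have nonzero: "a \<noteq> 0" "b \<noteq> 0" "c \<noteq> 0" "q \<noteq> 0" "x \<noteq> 0" "K \<noteq> 0" "M \<noteq> 0"
    using abc.nonzero abc.q_nonzero by (simp_all add: x_def K_def M_def)
  have pairs: "(1 - b * M / (c * x)) / (1 - ?A * q / ?A * x) =
      - (b * M / (c * x)) * well_poised_ratio ?A q x ?A"
    "(1 - K / x) / (1 - ?A * q / (1 / K) * x) = - (K / x) * well_poised_ratio ?A q x (1 / K)"
    "(1 - K / M * a / b * x) / (1 - a * K / (c * q * x)) =
      - (?A * q / (K / M * a / b) * x) * well_poised_ratio ?A q x (K / M * a / b)"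
    "(1 - a * b * M / (q * x)) / (1 - ?A * q / (q / M / (a * b)) * x) =
      - (a * b * M / (q * x)) * well_poised_ratio ?A q x (q / M / (a * b))"
    by (rule well_poised_ratio_reflect_numerator well_poised_ratio_reflect_denominator;
      use nonzero in simp)+
  have arguments: "?A * q / ?A * x = q * x" "?A * q / (1 / K) * x = c * K / (b * M) * (q * x)"
    "K / M * a / b * x = a * K / (b * M) * x" "?A * q / (q / M / (a * b)) * x = a * c * x"
    using nonzero by (simp_all add: mult_ac)
  have "inner_coeff k (Suc j) = inner_coeff k j *
    (1 / q * (b * M / (c * x)) * (K / x) * (?A * q / (K / M * a / b) * x) * (a * b * M / (q * x))) *
    ((1 - ?A * q ^ (2 * Suc j)) / (1 - ?A * q ^ (2 * j))) *
    (\<Prod>p\<leftarrow>[?A, 1 / K, K / M * a / b, q / M / (a * b)]. well_poised_ratio ?A q x p)"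
    unfolding inner_coeff_Suc[OF assms, folded x_def K_def M_def]
      W_base_linear_ratio[of j, folded x_def M_def] pairs[unfolded arguments]
    by (simp add: mult_ac)
  also have "1 / q * (b * M / (c * x)) * (K / x) * (?A * q / (K / M * a / b) * x) *
      (a * b * M / (q * x)) = b\<^sup>2 * M\<^sup>2 / (q * x\<^sup>2)"
    using nonzero by (simp add: power2_eq_square mult_ac)
  finally show ?thesis
    by (simp only: x_def K_def M_def)
qed

lemma outer_coeff_Suc_well_poised:
  assumes "j < l" "l \<le> N"
  shows "outer_coeff l (Suc j) = outer_coeff l j * (q\<^sup>2 * (q ^ j)\<^sup>2 / (b\<^sup>2 * (q ^ N)\<^sup>2)) *
    (\<Prod>p\<leftarrow>[1 / q ^ l, q ^ l / q ^ N * c / d, c * d, q * c / b].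
      well_poised_ratio W_base q (q ^ j) p)"
proof -
  define x L M where "x = q ^ j" and "L = q ^ l" and "M = q ^ N"
  let ?A = "c / (b * M)"
  have nonzero: "b \<noteq> 0" "c \<noteq> 0" "d \<noteq> 0" "q \<noteq> 0" "x \<noteq> 0" "L \<noteq> 0" "M \<noteq> 0"
    using bcd.nonzero bcd.q_nonzero by (simp_all add: x_def L_def M_def)
  have "M / L - c * x / d = M / L * (1 - L / M * c / d * x)"
    using nonzero by (simp add: field_simps)
  then have linear: "(M / L - c * x / d) / z = M / L * ((1 - L / M * c / d * x) / z)" for z
    by simp
  have pairs: "(1 - c * d * x) / (1 - b * d * M / (q * x)) =
      - (?A * q / (c * d) * x) * well_poised_ratio ?A q x (c * d)"
    "(1 - L / x) / (1 - b * M / (c * q * x * L)) =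
      L / x * (?A * q / (1 / L) * x) * well_poised_ratio ?A q x (1 / L)"
    "(1 - L / M * c / d * x) / (1 - b * L / (d * q * x)) =
      - (?A * q / (L / M * c / d) * x) * well_poised_ratio ?A q x (L / M * c / d)"
    "(1 - b / (c * q * x)) / (1 - M / x) =
      b / (c * q * x) * (?A * q / (q * c / b) * x) * well_poised_ratio ?A q x (q * c / b)"
    by (rule well_poised_ratio_reflect well_poised_ratio_reflect_denominator; use nonzero in simp)+
  have "outer_coeff l (Suc j) = outer_coeff l j *
    ((?A * q / (c * d) * x) * (L / x * (?A * q / (1 / L) * x)) *
      (M / L * (?A * q / (L / M * c / d) * x)) * (b / (c * q * x) * (?A * q / (q * c / b) * x))) *
    (\<Prod>p\<leftarrow>[1 / L, L / M * c / d, c * d, q * c / b]. well_poised_ratio ?A q x p)"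
    unfolding outer_coeff_Suc[OF assms, folded x_def L_def M_def] linear pairs
    by (simp add: mult_ac)
  also have "(?A * q / (c * d) * x) * (L / x * (?A * q / (1 / L) * x)) *
      (M / L * (?A * q / (L / M * c / d) * x)) * (b / (c * q * x) * (?A * q / (q * c / b) * x)) =
      q\<^sup>2 * x\<^sup>2 / (b\<^sup>2 * M\<^sup>2)"
    using nonzero by (simp add: power2_eq_square mult_ac)
  finally show ?thesis
    by (simp only: x_def L_def M_def)
qed

lemma Rcoef_eq_vwpW:
  assumes "k \<le> N" "l \<le> N"
  shows "Rcoef a b c d N q k l = inner_coeff k 0 * outer_coeff l 0 * vwpW W_base (W_params k l) q q"
proof -
  define e m where "e = N - k" and "m = N - l"
  have N_eq: "N = e + k" "N = l + m"
    using assms by (simp_all add: e_def m_def)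
  have qpoch_split: "qpoch z q N = qpoch z q e * qpoch (z * q ^ e) q k"
    "qpoch z q N = qpoch z q l * qpoch (z * q ^ l) q m" for z
    using qpoch_add[of z q e k] qpoch_add[of z q l m] N_eq by simp_all
  have nonvanishing: "qpoch (b * c) q i \<noteq> 0" "qpoch (b / c) q i \<noteq> 0" if "i \<le> N" for i
    using generic_pair_qpoch_nonzero[OF abc.generic_bc] that by simp_all
  have quotient_bc: "qpoch (b / c) q e / qpoch (b / c) q N = 1 / qpoch (b / c * q ^ e) q k"
    unfolding qpoch_split(1) using nonvanishing(2)[of e] N_eq by simp
  have quotient_mult_bc: "qpoch (b * c) q e / qpoch (b * c) q l =
      qpoch (b * c * q ^ l) q m / qpoch (b * c * q ^ e) q k"
    using nonvanishing(1)[of l] nonvanishing(1)[of N] qpoch_split[of "b * c"] N_eq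
    by (subst frac_eq_eq) (auto simp: mult.commute)
  note powi = power_int_nat_diff[OF abc.q_nonzero]
  have "int l * (int l - int N) = - int (l * m)"
    by (simp add: N_eq(2) algebra_simps)
  then have prefactor_power: "q powi (int l * (int l - int N)) = 1 / q ^ (l * m)"
    by (simp only: powi)
  have arguments: "q ^ l / q ^ N * c / d = c / d / q ^ m" "1 / q ^ l * d / c = d / c / q ^ l"
    "1 / q ^ N * c / b = W_base" "q ^ m * b * d = b * d * q ^ m"
    using abc.q_nonzero by (simp_all add: N_eq(2) power_add)
  have "Rcoef a b c d N q k l = (1 / q ^ (l * m) * qbinom N l q *
      (qpoch (b / d) q l * qpoch (b * d * q ^ m) q l * qpoch (b / c) q m) /
      (qpoch (c * d) q N * qpoch (c / d / q ^ m) q l * qpoch (d / c / q ^ l) q m)) *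
      (qpoch (a / c) q k * qpoch (a * c) q k) *
      (qpoch (b / c) q e / qpoch (b / c) q N) * (qpoch (b * c) q e / qpoch (b * c) q l) *
      vwpW W_base (W_params k l) q q"
    unfolding Rcoef_def prefactor_power powi e_def[symmetric] m_def[symmetric] arguments
    by (simp add: mult_ac)
  then show ?thesis
    unfolding quotient_bc quotient_mult_bc inner_coeff_0[OF assms(1), folded e_def]
      outer_coeff_0[OF assms(2), folded m_def] by (simp add: mult_ac)
qed

lemma vwpW_eq_sum:
  "vwpW W_base (W_params k l) q q = (\<Sum>j\<le>min k l. vwp_term W_base (W_params k l) q q j)"
proof -
  have "vwp_term W_base (W_params k l) q q j = 0" if "j \<notin> {..min k l}" for j
  proof -
    have "k < j \<or> l < j"
      using that by auto
    then have "qpoch (1 / q ^ k) q j = 0 \<or> qpoch (1 / q ^ l) q j = 0"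
      using abc.q_nonzero by (auto simp: qpoch_eq_0_iff)
    then show ?thesis
      by (auto simp: vwp_term_def)
  qed
  then show ?thesis
    unfolding vwpW_def by (intro suminf_finite) auto
qed

lemma W_base_power_neq_1:
  assumes "j \<le> N"
  shows "1 - W_base * q ^ (2 * j) \<noteq> 0"
proof -
  have "b * q ^ (N - j) * q ^ j \<noteq> c * q ^ j * q ^ j"
    using generic_pair_power_neq[OF abc.generic_bc, of "N - j" j] assms abc.q_nonzero by simp
  moreover have "q ^ N = q ^ (N - j) * q ^ j" "q ^ (2 * j) = q ^ j * q ^ j"
    using assms by (simp_all add: mult_2 flip: power_add)
  ultimately have "b * q ^ N \<noteq> c * q ^ (2 * j)"
    by simp
  then show ?thesis
    using abc.nonzero abc.q_nonzero by (simp add: field_simps)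
qed

lemma coeff_product_eq_vwp_term:
  assumes "k \<le> N" "l \<le> N"
  shows "j \<le> min k l \<Longrightarrow> inner_coeff k j * outer_coeff l j =
    inner_coeff k 0 * outer_coeff l 0 * vwp_term W_base (W_params k l) q q j"
proof (induction j)
  case 0
  show ?case
    using W_base_power_neq_1[of 0] by (simp add: vwp_term_0)
next
  case (Suc j)
  let ?well_poised = "\<lambda>ps. \<Prod>p\<leftarrow>ps. well_poised_ratio W_base q (q ^ j) p"
  let ?linear = "(1 - W_base * q ^ (2 * Suc j)) / (1 - W_base * q ^ (2 * j))"
  let ?monomials = "b\<^sup>2 * (q ^ N)\<^sup>2 / (q * (q ^ j)\<^sup>2) * (q\<^sup>2 * (q ^ j)\<^sup>2 / (b\<^sup>2 * (q ^ N)\<^sup>2))"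
  have bounds: "j < k" "j < l" "j \<le> N"
    using Suc.prems assms by auto
  have nonzero: "W_base \<noteq> 0" "b \<noteq> 0" "q \<noteq> 0"
    using abc.nonzero abc.q_nonzero by simp_all
  have "inner_coeff k (Suc j) * outer_coeff l (Suc j) = inner_coeff k j * outer_coeff l j *
      ?monomials * (?linear * ?well_poised (W_base # W_params k l))"
    unfolding inner_coeff_Suc_well_poised[OF bounds(1) assms(1)]
      outer_coeff_Suc_well_poised[OF bounds(2) assms(2)] by (simp add: mult_ac)
  also have "?monomials = q"
    using nonzero by (simp add: power2_eq_square)
  finally show ?case
    using Suc.IH Suc.prems unfolding vwp_term_Suc[OF nonzero(1) W_base_power_neq_1[OF bounds(3)]]
    by (simp add: mult_ac)
qed

lemma Rcoef_eq_sum: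
  assumes "k \<le> N" "l \<le> N"
  shows "Rcoef a b c d N q k l = (\<Sum>j\<le>min k l. inner_coeff k j * outer_coeff l j)"
  unfolding Rcoef_eq_vwpW[OF assms] vwpW_eq_sum sum_distrib_left
  by (intro sum.cong refl coeff_product_eq_vwp_term[OF assms, symmetric]) simp

theorem h_poly_product_expansion_iff:
  assumes "k \<le> N"
  shows "h_poly k a q * h_poly (N - k) b q =
      (\<Sum>l\<le>N. smult (r l) (h_poly l c q * h_poly (N - l) d q)) \<longleftrightarrow>
    (\<forall>l\<le>N. r l = Rcoef a b c d N q k l)" (is "?lhs = ?sum r \<longleftrightarrow> _")
proof -
  have expansion: "?lhs = ?sum (Rcoef a b c d N q k)"
    using h_poly_product_expansion[OF assms] Rcoef_eq_sum[OF assms] by simp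
  show ?thesis
  proof
    assume "?lhs = ?sum r"
    then have "?sum (\<lambda>l. r l - Rcoef a b c d N q k l) = 0"
      using expansion by (simp add: smult_diff_left sum_subtractf)
    from h_poly_products_independent[OF bcd.generic_bc bcd.q_nonzero this]
    show "\<forall>l\<le>N. r l = Rcoef a b c d N q k l"
      by simp
  next
    assume "\<forall>l\<le>N. r l = Rcoef a b c d N q k l"
    then show "?lhs = ?sum r"
      unfolding expansion by (intro sum.cong) auto
  qed
qed

end

section \<open>Nonempty Zariski-open sets of parameters\<close>

definition is_poly5 :: "(complex \<Rightarrow> complex \<Rightarrow> complex \<Rightarrow> complex \<Rightarrow> complex \<Rightarrow> complex) \<Rightarrow> bool" where
  "is_poly5 f \<longleftrightarrow> (\<exists>C. finite {e. C e \<noteq> 0} \<and> mpoly5_eval C = f)"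

lemma mpoly5_eval_superset:
  assumes "finite S" "{e. C e \<noteq> 0} \<subseteq> S"
  shows "mpoly5_eval C a b c d q =
    (\<Sum>e\<in>S. case e of (i, j, k, l, m) \<Rightarrow> C e * a ^ i * b ^ j * c ^ k * d ^ l * q ^ m)"
  unfolding mpoly5_eval_def using assms by (intro sum.mono_neutral_left) auto

lemma is_poly5_monomial: "is_poly5 (\<lambda>a b c d q. x * a ^ i * b ^ j * c ^ k * d ^ l * q ^ m)"
proof -
  let ?C = "\<lambda>e. if e = (i, j, k, l, m) then x else 0"
  have "{e. ?C e \<noteq> 0} \<subseteq> {(i, j, k, l, m)}"
    by auto
  then have "finite {e. ?C e \<noteq> 0}"
    "mpoly5_eval ?C a b c d q = x * a ^ i * b ^ j * c ^ k * d ^ l * q ^ m" for a b c d q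
    by (auto intro: finite_subset simp: mpoly5_eval_superset[of "{(i, j, k, l, m)}"])
  then show ?thesis
    unfolding is_poly5_def by (intro exI[of _ ?C] conjI ext)
qed

lemma is_poly5_add:
  assumes "is_poly5 f" "is_poly5 g"
  shows "is_poly5 (\<lambda>a b c d q. f a b c d q + g a b c d q)"
proof -
  obtain C D where finite: "finite {e. C e \<noteq> 0}" "finite {e. D e \<noteq> 0}"
    and eval: "mpoly5_eval C = f" "mpoly5_eval D = g"
    using assms unfolding is_poly5_def by blast
  let ?S = "{e. C e \<noteq> 0} \<union> {e. D e \<noteq> 0}"
  have support: "finite ?S" "{e. C e + D e \<noteq> 0} \<subseteq> ?S"
    using finite by auto
  have "mpoly5_eval (\<lambda>e. C e + D e) a b c d q = f a b c d q + g a b c d q" for a b c d q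
    unfolding eval[symmetric] mpoly5_eval_superset[OF support]
      mpoly5_eval_superset[OF support(1) Un_upper1] mpoly5_eval_superset[OF support(1) Un_upper2]
      sum.distrib[symmetric]
    by (intro sum.cong) (auto simp: algebra_simps)
  then show ?thesis
    unfolding is_poly5_def
    by (intro exI[of _ "\<lambda>e. C e + D e"] conjI ext finite_subset[OF support(2,1)])
qed

lemma is_poly5_const: "is_poly5 (\<lambda>a b c d q. x)"
  using is_poly5_monomial[of x 0 0 0 0 0] by simp

lemma is_poly5_sum:
  assumes "\<And>i. i \<in> I \<Longrightarrow> is_poly5 (f i)"
  shows "is_poly5 (\<lambda>a b c d q. \<Sum>i\<in>I. f i a b c d q)"
  using assms
  by (induction I rule: infinite_finite_induct) (simp_all add: is_poly5_const is_poly5_add)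

lemma is_poly5_mult:
  assumes "is_poly5 f" "is_poly5 g"
  shows "is_poly5 (\<lambda>a b c d q. f a b c d q * g a b c d q)"
proof -
  obtain C D where eval: "mpoly5_eval C = f" "mpoly5_eval D = g"
    using assms unfolding is_poly5_def by blast
  have "is_poly5 (\<lambda>a b c d q.
      (case e of (i, j, k, l, m) \<Rightarrow> C e * a ^ i * b ^ j * c ^ k * d ^ l * q ^ m) *
      (case e' of (i, j, k, l, m) \<Rightarrow> D e' * a ^ i * b ^ j * c ^ k * d ^ l * q ^ m))" for e e'
  proof -
    obtain i j k l m i' j' k' l' m'
      where exponents: "e = (i, j, k, l, m)" "e' = (i', j', k', l', m')"
      by (cases e, cases e')
    show ?thesis
      using is_poly5_monomial[of "C e * D e'" "i + i'" "j + j'" "k + k'" "l + l'" "m + m'"]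
      by (simp add: exponents power_add mult_ac)
  qed
  then show ?thesis
    unfolding eval[symmetric] mpoly5_eval_def sum_product by (intro is_poly5_sum)
qed

lemma is_poly5_var:
  "is_poly5 (\<lambda>a b c d q. a)" "is_poly5 (\<lambda>a b c d q. b)" "is_poly5 (\<lambda>a b c d q. c)"
  "is_poly5 (\<lambda>a b c d q. d)" "is_poly5 (\<lambda>a b c d q. q)"
  using is_poly5_monomial[of 1 1 0 0 0 0] is_poly5_monomial[of 1 0 1 0 0 0]
    is_poly5_monomial[of 1 0 0 1 0 0] is_poly5_monomial[of 1 0 0 0 1 0]
    is_poly5_monomial[of 1 0 0 0 0 1] by simp_all

lemma is_poly5_diff:
  assumes "is_poly5 f" "is_poly5 g"
  shows "is_poly5 (\<lambda>a b c d q. f a b c d q - g a b c d q)"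
  using is_poly5_add[OF assms(1) is_poly5_mult[OF is_poly5_const[of "-1"] assms(2)]] by simp

lemma is_poly5_power: "is_poly5 f \<Longrightarrow> is_poly5 (\<lambda>a b c d q. f a b c d q ^ n)"
  by (induction n) (simp_all add: is_poly5_const is_poly5_mult)

lemma is_poly5_prod:
  assumes "\<And>i. i \<in> I \<Longrightarrow> is_poly5 (f i)"
  shows "is_poly5 (\<lambda>a b c d q. \<Prod>i\<in>I. f i a b c d q)"
  using assms
  by (induction I rule: infinite_finite_induct) (simp_all add: is_poly5_const is_poly5_mult)

definition pair_discriminant :: "nat \<Rightarrow> complex \<Rightarrow> complex \<Rightarrow> complex \<Rightarrow> complex" where
  "pair_discriminant n q x y =
     x * y * (\<Prod>j\<le>n. 1 - x * y * q ^ j) * (\<Prod>i\<le>n. \<Prod>j\<le>n. x * q ^ i - y * q ^ j)"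

lemma pair_discriminant_nonzero_iff: "pair_discriminant n q x y \<noteq> 0 \<longleftrightarrow> generic_pair n q x y"
  by (auto simp: pair_discriminant_def generic_pair_def)

lemma is_poly5_pair_discriminant:
  assumes "is_poly5 f" "is_poly5 g"
  shows "is_poly5 (\<lambda>a b c d q. pair_discriminant n q (f a b c d q) (g a b c d q))"
  unfolding pair_discriminant_def
  by (intro is_poly5_mult is_poly5_prod is_poly5_diff is_poly5_power is_poly5_const is_poly5_var
      assms)

lemma odd_mult_power_2_eqD:
  fixes x y :: nat
  assumes "odd x" "odd y" "x * 2 ^ i = y * 2 ^ j"
  shows "x = y"
  using assms by (induction i j rule: diff_induct) (auto simp: even_mult_iff)

lemma generic_pair_odd:
  assumes "odd x" "odd y" "x \<noteq> y" "x > 1"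
  shows "generic_pair n 2 (of_nat x) (of_nat y)"
proof -
  have "x * y * 2 ^ j \<noteq> 1" "x * 2 ^ i \<noteq> y * 2 ^ j" for i j
    using assms odd_mult_power_2_eqD[of x y i j] by auto
  then have "of_nat (x * y * 2 ^ j) \<noteq> (of_nat 1 :: complex)"
    "of_nat (x * 2 ^ i) \<noteq> (of_nat (y * 2 ^ j) :: complex)" for i j
    unfolding of_nat_eq_iff by blast+
  then show ?thesis
    using assms by (auto simp: generic_pair_def odd_pos)
qed

lemma ex_poly5_generic_quadruple:
  "\<exists>C. finite {e. C e \<noteq> 0} \<and> C \<noteq> (\<lambda>_. 0) \<and>
     (\<forall>a b c d q. mpoly5_eval C a b c d q \<noteq> 0 \<longrightarrow> generic_quadruple N q a b c d)"
proof -
  define f where "f a b c d q = q * (\<Prod>j<N. 1 - q ^ Suc j) *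
    pair_discriminant N q a b * pair_discriminant N q a c * pair_discriminant N q b c *
    pair_discriminant N q b d * pair_discriminant N q c d" for a b c d q
  have f_nonzero_iff: "f a b c d q \<noteq> 0 \<longleftrightarrow> generic_quadruple N q a b c d" for a b c d q
    by (auto simp: f_def generic_quadruple_def generic_triple_def pair_discriminant_nonzero_iff
        simp del: power_Suc)
  have "is_poly5 f"
    unfolding f_def
    by (intro is_poly5_mult is_poly5_pair_discriminant is_poly5_prod is_poly5_diff is_poly5_power
        is_poly5_const is_poly5_var)
  then obtain C where C_finite: "finite {e. C e \<noteq> 0}" and C_eval: "mpoly5_eval C = f"
    unfolding is_poly5_def by blast
  have "generic_pair N 2 3 5" "generic_pair N 2 3 7" "generic_pair N 2 5 7" "generic_pair N 2 5 11"
    "generic_pair N 2 7 11"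
    using generic_pair_odd[of 3 5] generic_pair_odd[of 3 7] generic_pair_odd[of 5 7]
      generic_pair_odd[of 5 11] generic_pair_odd[of 7 11] by simp_all
  moreover have "2 ^ Suc j \<noteq> (1 :: complex)" for j
    using of_nat_eq_iff[of "2 ^ Suc j" 1, where ?'a = complex] by simp
  ultimately have "f 3 5 7 11 2 \<noteq> 0"
    unfolding f_nonzero_iff generic_quadruple_def generic_triple_def by simp
  then have "C \<noteq> (\<lambda>_. 0)"
    unfolding C_eval[symmetric] by (auto simp: mpoly5_eval_def)
  with C_finite C_eval f_nonzero_iff show ?thesis
    by auto
qed

theorem mainTheorem3:
  fixes N :: nat
  shows "\<exists>C :: nat \<times> nat \<times> nat \<times> nat \<times> nat \<Rightarrow> complex.
           finite {e. C e \<noteq> 0} \<and> C \<noteq> (\<lambda>_. 0) \<and>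
           (\<forall>a b c d q. mpoly5_eval C a b c d q \<noteq> 0 \<longrightarrow>
              (\<forall>R :: nat \<Rightarrow> nat \<Rightarrow> complex.
                 (\<forall>k\<le>N. h_poly k a q * h_poly (N - k) b q =
                     (\<Sum>l\<le>N. smult (R k l) (h_poly l c q * h_poly (N - l) d q)))
                 \<longleftrightarrow> (\<forall>k\<le>N. \<forall>l\<le>N. R k l = Rcoef a b c d N q k l)))"
proof -
  obtain C where C: "finite {e. C e \<noteq> 0}" "C \<noteq> (\<lambda>_. 0)"
    and generic: "\<And>a b c d q. mpoly5_eval C a b c d q \<noteq> 0 \<Longrightarrow> generic_quadruple N q a b c d"
    using ex_poly5_generic_quadruple[of N] by blast
  show ?thesis
    by (intro exI[of _ C] conjI C allI impI)
      (simp add: generic_quadruple.h_poly_product_expansion_iff[OF generic])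
qed

end
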